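(* Let $X$ be a Tychonoff space. Every maximal ideal of the semiring $C_{+}(X)$ is a maximal clique in $\Gamma(C_{+}(X))$.
   Context: For a Tychonoff space $X$, $C_{+}(X)$ is the commutative semiring of non-negative real-valued continuous functions on $X$ with pointwise operations. An ideal of a commutative semiring $S$ is a nonempty subset $I$ with $a+b\in I$ and $as\in I$ for all $a,b\in I$, $s\in S$; a maximal ideal is a proper ideal not contained in any other proper ideal. For $f\in C_{+}(X)$, $Z(f)=\{x\in X: f(x)=0\}$, and $\mathcal{N}'(X)$ is the set of non-units of $C_{+}(X)$ (functions with $Z(f)\neq\emptyset$). The zero-set intersection graph $\Gamma(C_{+}(X))$ has vertex set $\mathcal{N}'(X)$, with distinct vertices $f,g$ adjacent iff $Z(f)\cap Z(g)\neq\emptyset$. A clique is a nonempty set of vertices any two distinct members of which are adjacent; a maximal clique is a clique maximal with respect to inclusion. *)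

theory Defs
  imports "HOL-Analysis.Analysis" "HOL-Algebra.Ring" "HOL-Library.Ramsey"
begin

definition tychonoff_space :: "'a topology \<Rightarrow> bool" where
  "tychonoff_space X \<longleftrightarrow> completely_regular_space X \<and> Hausdorff_space X"

(* Functions on X are total HOL functions normalised to be undefined off the
   carrier of X; hence the restrictions, and equality in C_plus X is equality
   of functions on X. *)
definition C_plus :: "'a topology \<Rightarrow> ('a \<Rightarrow> real) ring" where
  "C_plus X =
    \<lparr> carrier = {f \<in> extensional (topspace X).
                  continuous_map X euclideanreal f \<and> (\<forall>x \<in> topspace X. 0 \<le> f x)},
      mult = (\<lambda>f g. \<lambda>x \<in> topspace X. f x * g x),
      one = (\<lambda>x \<in> topspace X. 1),
      zero = (\<lambda>x \<in> topspace X. 0),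
      add = (\<lambda>f g. \<lambda>x \<in> topspace X. f x + g x) \<rparr>"

(* For use with commutative semirings S, so multiplication on one side suffices. *)
definition semiring_ideal :: "'a set \<Rightarrow> ('a, 'm) ring_scheme \<Rightarrow> bool" where
  "semiring_ideal I S \<longleftrightarrow>
     I \<noteq> {} \<and> I \<subseteq> carrier S \<and>
     (\<forall>a \<in> I. \<forall>b \<in> I. a \<oplus>\<^bsub>S\<^esub> b \<in> I) \<and>
     (\<forall>a \<in> I. \<forall>s \<in> carrier S. a \<otimes>\<^bsub>S\<^esub> s \<in> I)"

definition proper_semiring_ideal :: "'a set \<Rightarrow> ('a, 'm) ring_scheme \<Rightarrow> bool" where
  "proper_semiring_ideal I S \<longleftrightarrow> semiring_ideal I S \<and> I \<noteq> carrier S"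

definition maximal_semiring_ideal :: "'a set \<Rightarrow> ('a, 'm) ring_scheme \<Rightarrow> bool" where
  "maximal_semiring_ideal I S \<longleftrightarrow>
     proper_semiring_ideal I S \<and>
     (\<forall>J. proper_semiring_ideal J S \<and> I \<subseteq> J \<longrightarrow> J = I)"

definition zero_set :: "'a topology \<Rightarrow> ('a \<Rightarrow> real) \<Rightarrow> 'a set" where
  "zero_set X f = {x \<in> topspace X. f x = 0}"

definition nonunits :: "'a topology \<Rightarrow> ('a \<Rightarrow> real) set" where
  "nonunits X = carrier (C_plus X) - Units (C_plus X)"

(* A simple graph is a pair of a vertex set and a set of two-element edges. *)
definition zero_set_graph :: "'a topology \<Rightarrow> ('a \<Rightarrow> real) set \<times> ('a \<Rightarrow> real) set set" where
  "zero_set_graph X =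
     (nonunits X,
      {{f, g} | f g. f \<in> nonunits X \<and> g \<in> nonunits X \<and> f \<noteq> g \<and>
                     zero_set X f \<inter> zero_set X g \<noteq> {}})"

definition graph_clique :: "'v set \<times> 'v set set \<Rightarrow> 'v set \<Rightarrow> bool" where
  "graph_clique G K \<longleftrightarrow> K \<noteq> {} \<and> K \<subseteq> fst G \<and> clique K (snd G)"

definition maximal_clique :: "'v set \<times> 'v set set \<Rightarrow> 'v set \<Rightarrow> bool" where
  "maximal_clique G K \<longleftrightarrow>
     graph_clique G K \<and> (\<forall>L. graph_clique G L \<and> K \<subseteq> L \<longrightarrow> L = K)"

lemma C_plus_simps:
  "f \<in> carrier (C_plus X) \<longleftrightarrow> f \<in> extensional (topspace X) \<and>
     continuous_map X euclideanreal f \<and> (\<forall>x \<in> topspace X. 0 \<le> f x)"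
  "f \<otimes>\<^bsub>C_plus X\<^esub> g = (\<lambda>x \<in> topspace X. f x * g x)"
  "f \<oplus>\<^bsub>C_plus X\<^esub> g = (\<lambda>x \<in> topspace X. f x + g x)"
  "\<one>\<^bsub>C_plus X\<^esub> = (\<lambda>x \<in> topspace X. 1)"
  "\<zero>\<^bsub>C_plus X\<^esub> = (\<lambda>x \<in> topspace X. 0)"
  by (auto simp: C_plus_def)

lemma continuous_map_restrict_real:
  assumes "continuous_map X euclideanreal f"
  shows "continuous_map X euclideanreal (\<lambda>x \<in> topspace X. f x)"
  using assms by (rule continuous_map_eq) simp

lemma C_plus_semiring: "semiring (C_plus X)"
proof (intro semiring.intro abelian_monoidI monoidI semiring_axioms.intro)
qed (auto simp: C_plus_simps extensional_def fun_eq_iff algebra_simps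
      intro!: continuous_map_restrict_real continuous_map_add continuous_map_real_mult)

lemma C_plus_comm_monoid: "comm_monoid (C_plus X)"
proof (rule comm_monoidI)
qed (auto simp: C_plus_simps extensional_def fun_eq_iff algebra_simps
      intro!: continuous_map_restrict_real continuous_map_real_mult)

lemma nonunits_eq: "nonunits X = {f \<in> carrier (C_plus X). zero_set X f \<noteq> {}}"
proof -
  have "f \<in> Units (C_plus X) \<longleftrightarrow> zero_set X f = {}" if f: "f \<in> carrier (C_plus X)" for f
  proof
    assume "f \<in> Units (C_plus X)"
    then obtain g where g: "(\<lambda>x \<in> topspace X. g x * f x) = (\<lambda>x \<in> topspace X. 1)"
      by (auto simp: Units_def C_plus_simps)
    have "g x * f x = 1" if "x \<in> topspace X" for x
      using fun_cong[OF g, of x] that by simp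
    then show "zero_set X f = {}"
      by (force simp: zero_set_def)
  next
    assume Z: "zero_set X f = {}"
    define g where "g = (\<lambda>x \<in> topspace X. inverse (f x))"
    have "continuous_map X euclideanreal g"
      unfolding g_def using f Z
      by (intro continuous_map_restrict_real continuous_map_real_inverse)
         (auto simp: C_plus_simps zero_set_def)
    with f have "g \<in> carrier (C_plus X)"
      by (auto simp: C_plus_simps g_def)
    moreover have "g \<otimes>\<^bsub>C_plus X\<^esub> f = \<one>\<^bsub>C_plus X\<^esub>" "f \<otimes>\<^bsub>C_plus X\<^esub> g = \<one>\<^bsub>C_plus X\<^esub>"
      using Z by (auto simp: C_plus_simps g_def zero_set_def fun_eq_iff)
    ultimately show "f \<in> Units (C_plus X)"
      using f unfolding Units_def by blast
  qed
  then show ?thesis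
    by (auto simp: nonunits_def)
qed

end

theory Submission
  imports Defs
begin

text \<open>
  If a function \<open>f\<close> lies outside the maximal ideal \<open>M\<close>, then \<open>M\<close> and \<open>f\<close> generate the whole
  semiring, so \<open>1 = m + f s\<close> with \<open>m \<in> M\<close>. Hence \<open>Z(m)\<close> and \<open>Z(f)\<close> are disjoint and \<open>f\<close> cannot
  be added to the clique \<open>M\<close>. That \<open>M\<close> is a clique follows from \<open>Z(f + g) = Z(f) \<inter> Z(g)\<close>
  for non-negative functions.
\<close>

text \<open>An ideal with a unit \<open>u\<close> absorbs every \<open>x\<close>, because
  \<open>x\<close> is the product of \<open>u\<close> and \<open>inv u\<close> times
  \<open>x\<close>; it would then be the whole carrier.\<close>

lemma proper_semiring_ideal_Units_disjoint:
  assumes "semiring S" and "proper_semiring_ideal I S"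
  shows "I \<inter> Units S = {}"
proof (rule ccontr)
  interpret semiring S by fact
  assume "I \<inter> Units S \<noteq> {}"
  then obtain u where u: "u \<in> I" "u \<in> Units S" by blast
  have I: "I \<subseteq> carrier S" "\<And>a s. a \<in> I \<Longrightarrow> s \<in> carrier S \<Longrightarrow> a \<otimes>\<^bsub>S\<^esub> s \<in> I" "I \<noteq> carrier S"
    using assms(2) by (auto simp: proper_semiring_ideal_def semiring_ideal_def)
  have "x \<in> I" if x: "x \<in> carrier S" for x
  proof -
    have "u \<otimes>\<^bsub>S\<^esub> (inv\<^bsub>S\<^esub> u \<otimes>\<^bsub>S\<^esub> x) \<in> I"
      using u x I(2) by simp
    moreover have "u \<otimes>\<^bsub>S\<^esub> (inv\<^bsub>S\<^esub> u \<otimes>\<^bsub>S\<^esub> x) = x"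
      using u x by (simp add: m_assoc[symmetric] Units_closed)
    ultimately show ?thesis by simp
  qed
  with I show False by blast
qed

text \<open>The elements \<open>m + f s\<close> form an ideal \<open>J\<close> that contains
  \<open>M\<close> and \<open>f\<close>. By maximality \<open>J\<close> cannot be proper, so it
  contains the unit element.\<close>

lemma maximal_semiring_ideal_comaximal:
  assumes "semiring S" and "maximal_semiring_ideal M S"
    and f: "f \<in> carrier S" "f \<notin> M"
  obtains m s where "m \<in> M" "s \<in> carrier S" "m \<oplus>\<^bsub>S\<^esub> f \<otimes>\<^bsub>S\<^esub> s = \<one>\<^bsub>S\<^esub>"
proof -
  interpret semiring S by fact
  define J where "J = {m \<oplus>\<^bsub>S\<^esub> f \<otimes>\<^bsub>S\<^esub> s | m s. m \<in> M \<and> s \<in> carrier S}"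
  have M: "M \<noteq> {}" "M \<subseteq> carrier S"
    and M_add: "\<And>a b. a \<in> M \<Longrightarrow> b \<in> M \<Longrightarrow> a \<oplus>\<^bsub>S\<^esub> b \<in> M"
    and M_mult: "\<And>a s. a \<in> M \<Longrightarrow> s \<in> carrier S \<Longrightarrow> a \<otimes>\<^bsub>S\<^esub> s \<in> M"
    and M_max: "\<And>J. proper_semiring_ideal J S \<Longrightarrow> M \<subseteq> J \<Longrightarrow> J = M"
    using assms(2)
    by (auto simp: maximal_semiring_ideal_def proper_semiring_ideal_def semiring_ideal_def)
  \<comment> \<open>Ideals are only required to be nonempty, so zero is obtained by multiplying some
    member of \<open>M\<close> by it. It is the \<open>M\<close>-summand that places
    \<open>f\<close> itself in \<open>J\<close>.\<close>
  have zero: "\<zero>\<^bsub>S\<^esub> \<in> M"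
    using M M_mult[OF _ zero_closed] by (metis all_not_in_conv r_null subsetD)
  have M_sub: "M \<subseteq> J"
  proof
    fix m assume m: "m \<in> M"
    then have "m = m \<oplus>\<^bsub>S\<^esub> f \<otimes>\<^bsub>S\<^esub> \<zero>\<^bsub>S\<^esub>"
      using M f by auto
    with m show "m \<in> J" unfolding J_def by blast
  qed
  have "f = \<zero>\<^bsub>S\<^esub> \<oplus>\<^bsub>S\<^esub> f \<otimes>\<^bsub>S\<^esub> \<one>\<^bsub>S\<^esub>"
    using f by simp
  with zero have "f \<in> J" unfolding J_def by blast
  have "semiring_ideal J S"
    unfolding semiring_ideal_def
  proof (intro conjI ballI)
    show "J \<noteq> {}" using M_sub M by blast
    show "J \<subseteq> carrier S" using M f by (auto simp: J_def)
  next
    fix a b assume "a \<in> J" "b \<in> J"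
    then obtain m s n t where
      a: "a = m \<oplus>\<^bsub>S\<^esub> f \<otimes>\<^bsub>S\<^esub> s" "m \<in> M" "s \<in> carrier S" and
      b: "b = n \<oplus>\<^bsub>S\<^esub> f \<otimes>\<^bsub>S\<^esub> t" "n \<in> M" "t \<in> carrier S"
      by (auto simp: J_def)
    have "m \<in> carrier S" "n \<in> carrier S" using a b M by auto
    then have "a \<oplus>\<^bsub>S\<^esub> b = (m \<oplus>\<^bsub>S\<^esub> n) \<oplus>\<^bsub>S\<^esub> f \<otimes>\<^bsub>S\<^esub> (s \<oplus>\<^bsub>S\<^esub> t)"
      using a b f by (simp add: r_distr a_ac)
    with a b M_add show "a \<oplus>\<^bsub>S\<^esub> b \<in> J" unfolding J_def by blast
  next
    fix a r assume "a \<in> J" and r: "r \<in> carrier S"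
    then obtain m s where a: "a = m \<oplus>\<^bsub>S\<^esub> f \<otimes>\<^bsub>S\<^esub> s" "m \<in> M" "s \<in> carrier S"
      by (auto simp: J_def)
    have "m \<in> carrier S" using a M by auto
    then have "a \<otimes>\<^bsub>S\<^esub> r = m \<otimes>\<^bsub>S\<^esub> r \<oplus>\<^bsub>S\<^esub> f \<otimes>\<^bsub>S\<^esub> (s \<otimes>\<^bsub>S\<^esub> r)"
      using a r f by (simp add: l_distr m_assoc)
    with a r M_mult show "a \<otimes>\<^bsub>S\<^esub> r \<in> J" unfolding J_def by blast
  qed
  \<comment> \<open>Were \<open>J\<close> proper, maximality would force \<open>J = M\<close>,
    contrary to \<open>f\<close> lying in \<open>J\<close> but not in \<open>M\<close>.\<close>
  with M_max M_sub \<open>f \<in> J\<close> f have "J = carrier S"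
    by (auto simp: proper_semiring_ideal_def)
  then have "\<one>\<^bsub>S\<^esub> \<in> J" by simp
  then show thesis using that by (auto simp: J_def)
qed

text \<open>This trades unordered edges for a condition on pairs of functions. An edge fixes its
  endpoints only up to order, which is harmless since intersection is symmetric.\<close>

lemma clique_zero_set_graph_iff:
  assumes "K \<subseteq> nonunits X"
  shows "clique K (snd (zero_set_graph X)) \<longleftrightarrow>
    (\<forall>f\<in>K. \<forall>g\<in>K. f \<noteq> g \<longrightarrow> zero_set X f \<inter> zero_set X g \<noteq> {})"
proof -
  have "{f, g} \<in> snd (zero_set_graph X) \<longleftrightarrow> zero_set X f \<inter> zero_set X g \<noteq> {}"
    if "f \<in> K" "g \<in> K" "f \<noteq> g" for f g
    using that assms unfolding zero_set_graph_def by (auto simp: doubleton_eq_iff)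
  then show ?thesis unfolding clique_def by blast
qed

text \<open>Non-negativity rules out cancellation: a sum of two non-negative reals vanishes only if
  both summands do.\<close>

lemma zero_set_add:
  assumes "f \<in> carrier (C_plus X)" "g \<in> carrier (C_plus X)"
  shows "zero_set X (f \<oplus>\<^bsub>C_plus X\<^esub> g) = zero_set X f \<inter> zero_set X g"
  using assms by (auto simp: zero_set_def C_plus_simps add_nonneg_eq_0_iff)

theorem theorem3p7:
  fixes X :: "'a topology" and M :: "('a \<Rightarrow> real) set"
  assumes "tychonoff_space X"
    and "maximal_semiring_ideal M (C_plus X)"
  shows "maximal_clique (zero_set_graph X) M"
proof -
  have proper: "proper_semiring_ideal M (C_plus X)"
    using assms(2) by (simp add: maximal_semiring_ideal_def)
  then have M: "M \<noteq> {}" "M \<subseteq> carrier (C_plus X)"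
    and M_add: "\<And>f g. f \<in> M \<Longrightarrow> g \<in> M \<Longrightarrow> f \<oplus>\<^bsub>C_plus X\<^esub> g \<in> M"
    by (auto simp: proper_semiring_ideal_def semiring_ideal_def)
  have nonunits: "M \<subseteq> nonunits X"
    using proper_semiring_ideal_Units_disjoint[OF C_plus_semiring proper] M
    by (auto simp: nonunits_def)
  \<comment> \<open>The sum of \<open>f\<close> and \<open>g\<close> stays in \<open>M\<close>,
    hence is a non-unit and has a zero, which is a common zero of \<open>f\<close> and
    \<open>g\<close>.\<close>
  have "zero_set X f \<inter> zero_set X g \<noteq> {}" if "f \<in> M" "g \<in> M" for f g
  proof -
    have "zero_set X (f \<oplus>\<^bsub>C_plus X\<^esub> g) \<noteq> {}"
      using M_add[OF that] nonunits by (auto simp: nonunits_eq)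
    then show ?thesis
      using that M by (simp add: zero_set_add subset_iff)
  qed
  then have "graph_clique (zero_set_graph X) M"
    using M nonunits clique_zero_set_graph_iff[OF nonunits]
    by (simp add: graph_clique_def) (simp add: zero_set_graph_def)
  moreover have "L = M" if L: "graph_clique (zero_set_graph X) L" "M \<subseteq> L" for L
  proof (rule ccontr)
    assume "L \<noteq> M"
    with L obtain f where f: "f \<in> L" "f \<notin> M" by blast
    have L_nonunits: "L \<subseteq> nonunits X" and "clique L (snd (zero_set_graph X))"
      using L(1) by (simp_all add: graph_clique_def) (simp add: zero_set_graph_def)
    then have meet: "zero_set X g \<inter> zero_set X h \<noteq> {}" if "g \<in> L" "h \<in> L" "g \<noteq> h" for g h
      using that clique_zero_set_graph_iff by blast
    have "f \<in> carrier (C_plus X)"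
      using f L_nonunits by (auto simp: nonunits_def)
    then obtain m s where m: "m \<in> M"
      and eq: "m \<oplus>\<^bsub>C_plus X\<^esub> f \<otimes>\<^bsub>C_plus X\<^esub> s = \<one>\<^bsub>C_plus X\<^esub>"
      using maximal_semiring_ideal_comaximal[OF C_plus_semiring assms(2)] f by metis
    \<comment> \<open>Both \<open>m\<close> and \<open>f\<close> lie in the clique \<open>L\<close>,
      and they differ because only \<open>m\<close> is in \<open>M\<close>. At a common zero
      \<open>x\<close> the equation \<open>eq\<close> reads \<open>0 = 1\<close>.\<close>
    obtain x where "x \<in> topspace X" "m x = 0" "f x = 0"
      using meet[of m f] m f L by (auto simp: zero_set_def)
    with fun_cong[OF eq, of x] show False
      by (simp add: C_plus_simps)
  qed
  ultimately show ?thesis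
    by (auto simp: maximal_clique_def)
qed

end
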